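(* Let $C,t>0$ and let $\nu$ be a Borel probability measure on $\mathbb{R}^q$ with compact support $K_\nu$ such that $|K_\nu|\leq 1$ and $\sup_{x\in\mathbb{R}^q}\nu(B(x,\epsilon))\leq C\epsilon^t$ for every $\epsilon>0$. For each $k\geq 2$, there exists a positive real number $\underline{d}_k$ such that, for every $\alpha_k\in C_k(\nu)$ and every Voronoi partition $\{P_a(\alpha_k)\}_{a\in\alpha_k}$ with respect to $\alpha_k$, we have \[ \min_{a\in\alpha_k}\nu(P_a(\alpha_k))\geq \underline{d}_k. \]
   Context: $d$ is the Euclidean metric on $\mathbb{R}^q$, $B(x,\epsilon)$ is the closed ball of radius $\epsilon$ centered at $x$, and $|B|$ is the diameter of a set $B$. For $x\in\mathbb{R}^q$ and non-empty $\alpha\subset\mathbb{R}^q$, $d(x,\alpha):=\inf_{a\in\alpha}d(x,a)$. For $k\geq1$, $C_k(\nu)$ is the collection of all sets $\alpha\subset\mathbb{R}^q$ with $1\leq\mathrm{card}(\alpha)\leq k$ at which the infimum $\inf\{\exp(\int\log d(x,\alpha)\,d\nu(x)):\alpha\subset\mathbb{R}^q,\,1\leq\mathrm{card}(\alpha)\leq k\}$ is attained ($k$-optimal sets of order zero). For a non-empty finite set $\alpha\subset\mathbb{R}^q$ and $a\in\alpha$, let $W(a|\alpha):=\{x\in\mathbb{R}^q:d(x,\alpha)=d(x,a)\}$. A Voronoi partition with respect to $\alpha$ is a Borel partition $\{P_a(\alpha)\}_{a\in\alpha}$ of $\mathbb{R}^q$ such that $P_a(\alpha)\subset W(a|\alpha)$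 for every $a\in\alpha$. *)

theory Defs
  imports "HOL-Probability.Probability"
begin

definition measure_support :: "'a::topological_space measure \<Rightarrow> 'a set" where
  "measure_support \<nu> = \<Inter>{F. closed F \<and> emeasure \<nu> (- F) = 0}"

(* The library has ln 0 = 0; here log 0 = -\<infinity>. *)
definition log_dist :: "'a::metric_space set \<Rightarrow> 'a \<Rightarrow> ereal" where
  "log_dist \<alpha> x = (if infdist x \<alpha> = 0 then -\<infinity> else ereal (ln (infdist x \<alpha>)))"

(* The Bochner integral is 0 on non-integrable functions, so the integral is taken as the
   difference of the integrals of the positive and negative parts (e2ennreal truncates at 0)
   and may be infinite.  For finite measures of bounded support the integral of the positive
   part is finite, so the indeterminate difference \<infinity> - \<infinity> does not occur there. *)
definition log_dist_integral :: "'a::metric_space measure \<Rightarrow> 'a set \<Rightarrow> ereal" where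
  "log_dist_integral \<nu> \<alpha> =
     enn2ereal (\<integral>\<^sup>+ x. e2ennreal (log_dist \<alpha> x) \<partial>\<nu>) -
     enn2ereal (\<integral>\<^sup>+ x. e2ennreal (- log_dist \<alpha> x) \<partial>\<nu>)"

definition exp_ereal :: "ereal \<Rightarrow> ennreal" where
  "exp_ereal x = (if x = \<infinity> then \<infinity> else if x = -\<infinity> then 0 else ennreal (exp (real_of_ereal x)))"

definition geometric_error :: "'a::metric_space measure \<Rightarrow> 'a set \<Rightarrow> ennreal" where
  "geometric_error \<nu> \<alpha> = exp_ereal (log_dist_integral \<nu> \<alpha>)"

definition codebooks :: "nat \<Rightarrow> 'a set set" where
  "codebooks k = {\<alpha>. finite \<alpha> \<and> 1 \<le> card \<alpha> \<and> card \<alpha> \<le> k}"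

definition optimal_sets :: "nat \<Rightarrow> 'a::metric_space measure \<Rightarrow> 'a set set" where
  "optimal_sets k \<nu> =
     {\<alpha> \<in> codebooks k. geometric_error \<nu> \<alpha> = (INF \<beta>\<in>codebooks k. geometric_error \<nu> \<beta>)}"

definition voronoi_region :: "'a::metric_space \<Rightarrow> 'a set \<Rightarrow> 'a set" where
  "voronoi_region a \<alpha> = {x. infdist x \<alpha> = dist x a}"

definition voronoi_partition :: "'a::metric_space set \<Rightarrow> ('a \<Rightarrow> 'a set) \<Rightarrow> bool" where
  "voronoi_partition \<alpha> P \<longleftrightarrow>
     (\<forall>a\<in>\<alpha>. P a \<in> sets borel \<and> P a \<subseteq> voronoi_region a \<alpha>) \<and>
     disjoint_family_on P \<alpha> \<and> (\<Union>a\<in>\<alpha>. P a) = UNIV"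

end

theory Submission
  imports Defs
begin

text \<open>
  Suppose that \<open>\<alpha>\<close> is optimal and that some \<open>a \<in> \<alpha>\<close> has a cell of tiny mass. Then
  \<open>\<alpha> - {a}\<close> still has a point at bounded distance from the support, since otherwise the integral of
  the logarithmic distance would be positive, whereas a single point of the support makes it
  nonpositive. As the negative parts of \<open>ln (dist x a)\<close> are uniformly integrable in \<open>a\<close>,
  deleting \<open>a\<close> then raises the integral only slightly. But no set of \<open>k\<close> points comes close to
  most of \<open>\<nu>\<close>, so adding one suitable point lowers the integral by an amount that depends on \<open>k\<close>
  only. Together this contradicts the optimality of \<open>\<alpha>\<close>.
\<close>

section \<open>The support and distances to finite sets\<close>

text \<open>The complement is the union of all open null sets; by the Lindelof property countably
  many of them already cover it.\<close>

lemma emeasure_compl_measure_support: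
  fixes \<nu> :: "'a::second_countable_topology measure"
  assumes "sets \<nu> = sets borel"
  shows "emeasure \<nu> (- measure_support \<nu>) = 0"
proof -
  define \<F> where "\<F> = {U. open U \<and> emeasure \<nu> U = 0}"
  have eq: "- measure_support \<nu> = \<Union>\<F>"
  proof -
    have "- measure_support \<nu> = (\<Union>F\<in>{F. closed F \<and> emeasure \<nu> (- F) = 0}. - F)"
      unfolding measure_support_def by blast
    also have "\<dots> = \<Union>\<F>"
    proof (intro equalityI subsetI)
      fix x assume "x \<in> \<Union>\<F>"
      then obtain U where "open U" "emeasure \<nu> U = 0" "x \<in> U" by (auto simp: \<F>_def)
      then show "x \<in> (\<Union>F\<in>{F. closed F \<and> emeasure \<nu> (- F) = 0}. - F)"
        by (intro UN_I[of "- U"]) auto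
    qed (auto simp: \<F>_def open_Compl)
    finally show ?thesis .
  qed
  obtain \<F>' where "\<F>' \<subseteq> \<F>" "countable \<F>'" "\<Union>\<F>' = \<Union>\<F>"
    using Lindelof[of \<F>] unfolding \<F>_def by blast
  moreover have "\<Union>\<F>' \<in> null_sets \<nu>"
    using calculation unfolding \<F>_def
    by (intro null_sets_UN'[where N = "\<lambda>x. x" and I = \<F>', simplified]) (auto simp: assms null_sets_def)
  ultimately show ?thesis
    using eq by auto
qed

lemma infdist_insert_le:
  assumes "A \<noteq> {}"
  shows "infdist x (insert b A) \<le> infdist x A"
  using assms by (intro infdist_mono) auto

lemma infdist_finite_attained:
  assumes "finite A" "A \<noteq> {}"
  obtains a where "a \<in> A" "infdist x A = dist x a"
proof -
  have "infdist x A \<in> dist x ` A"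
    using assms by (simp add: infdist_notempty cInf_eq_Min)
  then show thesis using that by auto
qed

text \<open>Such an \<open>x\<close> lies in the cell of another point \<open>b\<close>, which is
  nearest to \<open>x\<close> and survives the deletion of \<open>a\<close>.\<close>

lemma infdist_eq_infdist_Diff_if_notin_cell:
  assumes "voronoi_partition \<alpha> P" "a \<in> \<alpha>" "x \<notin> P a"
  shows "infdist x \<alpha> = infdist x (\<alpha> - {a})"
proof -
  obtain b where "b \<in> \<alpha>" "x \<in> P b" using assms(1) unfolding voronoi_partition_def by blast
  then have b: "b \<in> \<alpha> - {a}" "infdist x \<alpha> = dist x b"
    using assms by (auto simp: voronoi_partition_def voronoi_region_def)
  have "infdist x (\<alpha> - {a}) \<le> dist x b" using b by (intro infdist_le)
  moreover have "infdist x \<alpha> \<le> infdist x (\<alpha> - {a})"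
    using b by (intro infdist_mono) auto
  ultimately show ?thesis using b by simp
qed

section \<open>The negative part of the logarithmic distance to a point\<close>

text \<open>At \<open>x = a\<close> the value is 0 instead of infinity, because
  \<open>ln 0 = 0\<close>. This is harmless for measures without atoms.\<close>

definition neg_ln_dist :: "'a::metric_space \<Rightarrow> 'a \<Rightarrow> real" where
  "neg_ln_dist a x = max 0 (- ln (dist x a))"

lemma neg_ln_dist_nonneg: "0 \<le> neg_ln_dist a x"
  by (simp add: neg_ln_dist_def)

text \<open>Discrete layer-cake bound, which turns ball estimates into integral estimates: the
  series counts the radii \<open>exp (- n)\<close> that are at least
  \<open>dist x a\<close>.\<close>

lemma ennreal_neg_ln_dist_le:
  "ennreal (neg_ln_dist a x) \<le> (\<Sum>n. indicator (cball a (exp (- real n))) x)"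
proof (cases "x = a \<or> dist x a \<ge> 1")
  case True
  then have "neg_ln_dist a x = 0" by (auto simp: neg_ln_dist_def)
  then show ?thesis by simp
next
  case False
  then have d: "0 < dist x a" "dist x a < 1" by auto
  define l where "l = - ln (dist x a)"
  have l: "l > 0" unfolding l_def using d by simp
  define m where "m = nat \<lfloor>l\<rfloor>"
  have m: "real m \<le> l" "l \<le> real (Suc m)"
    unfolding m_def using l by linarith+
  have "indicator (cball a (exp (- real n))) x = (1::ennreal)" if "n \<le> m" for n
  proof -
    have "real n \<le> l" using that m by linarith
    then have "ln (dist x a) \<le> - real n" by (simp add: l_def)
    then have "dist x a \<le> exp (- real n)"
      using d by (metis exp_le_cancel_iff exp_ln)
    then show ?thesis by (simp add: dist_commute)
  qed
  \<comment> \<open>The indices 0 to \<open>m\<close> give \<open>m + 1\<close> summands; the unit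
    ball at index 0 makes up for rounding \<open>l\<close> down to \<open>m\<close>.\<close>
  then have "(\<Sum>n<Suc m. indicator (cball a (exp (- real n))) x) = (of_nat (Suc m) :: ennreal)"
    by (subst sum.cong[where h = "\<lambda>_. 1"]) auto
  moreover have "ennreal (neg_ln_dist a x) \<le> of_nat (Suc m)"
    using m l by (simp add: neg_ln_dist_def l_def[symmetric] flip: ennreal_of_nat_eq_real_of_nat del: of_nat_Suc)
  moreover have "(\<Sum>n<Suc m. indicator (cball a (exp (- real n))) x :: ennreal)
      \<le> (\<Sum>n. indicator (cball a (exp (- real n))) x)"
    by (intro sum_le_suminf) auto
  ultimately show ?thesis by simp
qed

text \<open>\<open>K\<close> stands for the support: a compact set of full measure, with the
  diameter bound stated pointwise.\<close>

locale upper_regular_measure = prob_space \<nu>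
  for \<nu> :: "'a::metric_space measure" +
  fixes K :: "'a set" and C t :: real
  assumes sets_eq [measurable_cong]: "sets \<nu> = sets borel"
    and C_pos: "C > 0" and t_pos: "t > 0"
    and compact_K: "compact K"
    and AE_in_K: "AE x in \<nu>. x \<in> K"
    and dist_K_le: "\<And>x y. x \<in> K \<Longrightarrow> y \<in> K \<Longrightarrow> dist x y \<le> 1"
    and measure_cball_le: "\<And>x \<epsilon>. \<epsilon> > 0 \<Longrightarrow> prob (cball x \<epsilon>) \<le> C * \<epsilon> powr t"
begin

lemma AE_neq: "AE x in \<nu>. x \<noteq> a"
proof -
  have "prob {a} = 0"
  proof (rule ccontr)
    assume "prob {a} \<noteq> 0"
    then have p: "prob {a} > 0" by (simp add: zero_less_measure_iff)
    \<comment> \<open>The radius at which the bound \<open>C * \<epsilon> powr t\<close> equals half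
      the mass of the supposed atom.\<close>
    define \<epsilon> where "\<epsilon> = (prob {a} / (2 * C)) powr (1 / t)"
    have "\<epsilon> > 0" unfolding \<epsilon>_def using p C_pos by simp
    have "prob {a} \<le> prob (cball a \<epsilon>)"
      using \<open>\<epsilon> > 0\<close> by (intro finite_measure_mono) (auto simp: sets_eq)
    also have "\<dots> \<le> C * \<epsilon> powr t" by (rule measure_cball_le) fact
    also have "\<dots> = prob {a} / 2"
      unfolding \<epsilon>_def using p C_pos t_pos by (simp add: powr_powr)
    finally show False using p by simp
  qed
  then show ?thesis
    by (intro AE_I[where N = "{a}"]) (auto simp: emeasure_eq_measure sets_eq)
qed

lemma AE_notin_finite:
  assumes "finite \<alpha>"
  shows "AE x in \<nu>. x \<notin> \<alpha>"
proof -
  have "AE x in \<nu>. \<forall>a\<in>\<alpha>. x \<noteq> a"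
    using assms AE_neq by (intro AE_finite_allI)
  then show ?thesis by eventually_elim auto
qed

lemma measurable_neg_ln_dist [measurable]: "neg_ln_dist a \<in> borel_measurable \<nu>"
proof -
  have "(\<lambda>x. dist x a) \<in> borel_measurable borel"
    by (intro borel_measurable_continuous_onI continuous_intros)
  then have [measurable]: "(\<lambda>x. dist x a) \<in> borel_measurable \<nu>"
    by measurable
  show ?thesis unfolding neg_ln_dist_def[abs_def] by measurable
qed

lemma measurable_ln_infdist [measurable]: "(\<lambda>x. ln (infdist x \<alpha>)) \<in> borel_measurable \<nu>"
proof -
  have "(\<lambda>x. infdist x \<alpha>) \<in> borel_measurable borel"
    by (intro borel_measurable_continuous_onI continuous_intros)
  then have [measurable]: "(\<lambda>x. infdist x \<alpha>) \<in> borel_measurable \<nu>"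
    by measurable
  show ?thesis by measurable
qed

section \<open>Uniform integrability of the negative parts\<close>

text \<open>Integrating the layer-cake series over \<open>A\<close> leaves the masses of
  \<open>A\<close> intersected with balls. The first \<open>N\<close> are bounded by the mass of
  \<open>A\<close>, the others by regularity, which yields a geometric tail. The bound is
  independent of \<open>a\<close>.\<close>

lemma nn_integral_neg_ln_dist_le:
  assumes [measurable]: "A \<in> sets \<nu>"
  shows "(\<integral>\<^sup>+x. ennreal (indicator A x * neg_ln_dist a x) \<partial>\<nu>) \<le>
    ennreal (real N * prob A + C * exp (- t) ^ N / (1 - exp (- t)))"
proof -
  have [measurable]: "cball a r \<in> sets \<nu>" for r by (simp add: sets_eq)
  define u where "u n = (if n < N then prob A else C * exp (- t) ^ n)" for n
  have u_nonneg: "0 \<le> u n" for n using C_pos by (simp add: u_def)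
  have "(\<lambda>n. (C * exp (- t) ^ N) * exp (- t) ^ n) sums ((C * exp (- t) ^ N) * (1 / (1 - exp (- t))))"
    using t_pos by (intro sums_mult geometric_sums) auto
  then have "(\<lambda>n. u (n + N)) sums (C * exp (- t) ^ N / (1 - exp (- t)))"
    by (simp add: u_def power_add mult_ac)
  then have u: "u sums (real N * prob A + C * exp (- t) ^ N / (1 - exp (- t)))"
    by (subst (asm) sums_iff_shift) (simp add: u_def add.commute)
  have "(\<integral>\<^sup>+x. ennreal (indicator A x * neg_ln_dist a x) \<partial>\<nu>)
      \<le> (\<integral>\<^sup>+x. (\<Sum>n. indicator (A \<inter> cball a (exp (- real n))) x) \<partial>\<nu>)"
    by (intro nn_integral_mono)
       (use ennreal_neg_ln_dist_le[of a] in \<open>auto simp: indicator_inter_arith split: split_indicator\<close>)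
  also have "\<dots> = (\<Sum>n. emeasure \<nu> (A \<inter> cball a (exp (- real n))))"
    by (subst nn_integral_suminf) auto
  also have "\<dots> \<le> (\<Sum>n. ennreal (u n))"
  proof (intro suminf_le allI)
    fix n
    have "prob (A \<inter> cball a (exp (- real n))) \<le> prob A"
      by (intro finite_measure_mono) auto
    moreover have "prob (A \<inter> cball a (exp (- real n))) \<le> prob (cball a (exp (- real n)))"
      by (intro finite_measure_mono) auto
    moreover have "prob (cball a (exp (- real n))) \<le> C * exp (- t) ^ n"
      using measure_cball_le[of "exp (- real n)" a]
      by (simp add: powr_def mult.commute flip: exp_of_nat_mult)
    ultimately have "prob (A \<inter> cball a (exp (- real n))) \<le> u n" by (auto simp: u_def)
    then show "emeasure \<nu> (A \<inter> cball a (exp (- real n))) \<le> ennreal (u n)"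
      by (simp add: emeasure_eq_measure ennreal_leI)
  qed auto
  also have "\<dots> = ennreal (real N * prob A + C * exp (- t) ^ N / (1 - exp (- t)))"
    using u u_nonneg by (subst suminf_ennreal2) (auto simp: sums_iff)
  finally show ?thesis .
qed

lemma integrable_neg_ln_dist: "integrable \<nu> (neg_ln_dist a)"
proof (rule integrableI_nonneg)
  have "(\<integral>\<^sup>+x. ennreal (neg_ln_dist a x) \<partial>\<nu>) \<le> ennreal (C / (1 - exp (- t)))"
    using nn_integral_neg_ln_dist_le[of UNIV a 0] by (simp add: sets_eq)
  then show "(\<integral>\<^sup>+x. ennreal (neg_ln_dist a x) \<partial>\<nu>) < \<infinity>"
    by (simp add: le_less_trans)
qed (auto simp: neg_ln_dist_nonneg)

lemma integrable_indicator_neg_ln_dist: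
  assumes [measurable]: "A \<in> sets \<nu>"
  shows "integrable \<nu> (\<lambda>x. indicator A x * neg_ln_dist a x)"
  using integrable_mult_indicator[OF assms integrable_neg_ln_dist] by simp

lemma integral_neg_ln_dist_le:
  assumes [measurable]: "A \<in> sets \<nu>"
  shows "(\<integral>x. indicator A x * neg_ln_dist a x \<partial>\<nu>) \<le>
    real N * prob A + C * exp (- t) ^ N / (1 - exp (- t))"
proof -
  have "ennreal (\<integral>x. indicator A x * neg_ln_dist a x \<partial>\<nu>) =
      (\<integral>\<^sup>+x. ennreal (indicator A x * neg_ln_dist a x) \<partial>\<nu>)"
    by (intro nn_integral_eq_integral[symmetric] integrable_indicator_neg_ln_dist)
       (auto simp: neg_ln_dist_nonneg)
  also have "\<dots> \<le> ennreal (real N * prob A + C * exp (- t) ^ N / (1 - exp (- t)))"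
    by (rule nn_integral_neg_ln_dist_le) fact
  finally show ?thesis
    using C_pos t_pos by (subst (asm) ennreal_le_iff) auto
qed

lemma uniformly_integrable_neg_ln_dist:
  assumes "\<epsilon> > 0"
  obtains \<delta> where "\<delta> > 0"
    "\<And>a A. A \<in> sets \<nu> \<Longrightarrow> prob A \<le> \<delta> \<Longrightarrow> (\<integral>x. indicator A x * neg_ln_dist a x \<partial>\<nu>) \<le> \<epsilon>"
proof -
  define B where "B = C / (1 - exp (- t))"
  have B: "B > 0" using C_pos t_pos by (simp add: B_def)
  \<comment> \<open>First \<open>N\<close> makes the geometric tail at most \<epsilon>/2; then
    \<delta> does the same for the term \<open>N * prob A\<close>. Dividing by \<open>N + 1\<close>
    in \<delta> covers the case \<open>N = 0\<close>.\<close>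
  obtain N where N: "exp (- t) ^ N < \<epsilon> / (2 * B)"
    using real_arch_pow_inv[of "\<epsilon> / (2 * B)" "exp (- t)"] assms B t_pos by auto
  define \<delta> where "\<delta> = \<epsilon> / (2 * (real N + 1))"
  show thesis
  proof
    show "\<delta> > 0" using assms by (simp add: \<delta>_def)
    fix a A assume A: "A \<in> sets \<nu>" "prob A \<le> \<delta>"
    have "(\<integral>x. indicator A x * neg_ln_dist a x \<partial>\<nu>) \<le> real N * prob A + C * exp (- t) ^ N / (1 - exp (- t))"
      using A(1) by (rule integral_neg_ln_dist_le)
    also have "C * exp (- t) ^ N / (1 - exp (- t)) = exp (- t) ^ N * B"
      by (simp add: B_def)
    also have "\<dots> \<le> \<epsilon> / 2" using N B by (simp add: field_simps)
    also have "real N * prob A \<le> (real N + 1) * \<delta>"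
      using A(2) by (intro mult_mono) auto
    also have "\<dots> = \<epsilon> / 2" by (simp add: \<delta>_def divide_simps)
    finally show "(\<integral>x. indicator A x * neg_ln_dist a x \<partial>\<nu>) \<le> \<epsilon>" by simp
  qed
qed

section \<open>The geometric error as a real integral\<close>

lemma K_nonempty: "K \<noteq> {}"
  using AE_in_K by auto

lemma ln_infdist_le:
  assumes "x \<in> K" "y \<in> K" "infdist y \<alpha> \<le> R" "R \<ge> 0"
  shows "ln (infdist x \<alpha>) \<le> ln (R + 1)"
\<comment> \<open>At distance 0 the left side is \<open>ln 0 = 0\<close>, and the bound holds
  because \<open>R\<close> is nonnegative. Otherwise the triangle inequality through
  \<open>y\<close> costs at most 1.\<close>
proof (cases "infdist x \<alpha> = 0")
  case False
  have "infdist x \<alpha> \<le> infdist y \<alpha> + dist x y" by (rule infdist_triangle)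
  also have "\<dots> \<le> R + 1" using assms dist_K_le by (simp add: add_mono)
  finally show ?thesis
    using False infdist_nonneg[of x \<alpha>] by (subst ln_le_cancel_iff) auto
qed (use assms in auto)

text \<open>On \<open>K\<close> the function is bounded above by a constant. From below, the nearest
  point of \<alpha> gives one negative part, and the sum over all of \<alpha> dominates it.\<close>

lemma integrable_ln_infdist:
  assumes "finite \<alpha>" "\<alpha> \<noteq> {}"
  shows "integrable \<nu> (\<lambda>x. ln (infdist x \<alpha>))"
proof -
  obtain y where y: "y \<in> K" using K_nonempty by auto
  define L where "L = ln (infdist y \<alpha> + 1)"
  have L: "L \<ge> 0" by (simp add: L_def infdist_nonneg)
  have "norm (ln (infdist x \<alpha>)) \<le> norm (L + (\<Sum>a\<in>\<alpha>. neg_ln_dist a x))" if "x \<in> K" for x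
  proof -
    have ub: "ln (infdist x \<alpha>) \<le> L"
      unfolding L_def using ln_infdist_le[OF that y order_refl] by (simp add: infdist_nonneg)
    obtain a where a: "a \<in> \<alpha>" "infdist x \<alpha> = dist x a"
      using assms by (rule infdist_finite_attained)
    have "- ln (infdist x \<alpha>) \<le> neg_ln_dist a x"
      by (simp add: a neg_ln_dist_def)
    also have "\<dots> \<le> (\<Sum>a\<in>\<alpha>. neg_ln_dist a x)"
      using assms a by (intro member_le_sum) (auto simp: neg_ln_dist_nonneg)
    finally have "- ln (infdist x \<alpha>) \<le> (\<Sum>a\<in>\<alpha>. neg_ln_dist a x)" .
    moreover have "(\<Sum>a\<in>\<alpha>. neg_ln_dist a x) \<ge> 0" by (intro sum_nonneg) (auto simp: neg_ln_dist_nonneg)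
    ultimately show ?thesis using L ub by auto
  qed
  then have "AE x in \<nu>. norm (ln (infdist x \<alpha>)) \<le> norm (L + (\<Sum>a\<in>\<alpha>. neg_ln_dist a x))"
    using AE_in_K by (rule eventually_mono[rotated])
  moreover have "integrable \<nu> (\<lambda>x. L + (\<Sum>a\<in>\<alpha>. neg_ln_dist a x))"
    by (intro Bochner_Integration.integrable_add Bochner_Integration.integrable_sum
          integrable_neg_ln_dist integrable_const)
  ultimately show ?thesis
    using measurable_ln_infdist by (rule Bochner_Integration.integrable_bound[rotated 2])
qed

text \<open>The two conventions for log 0 differ only on \<alpha>, a null set, and both parts have
  finite integral, so the extended difference is the Bochner integral.\<close>

lemma geometric_error_eq:
  assumes "finite \<alpha>" "\<alpha> \<noteq> {}"
  shows "geometric_error \<nu> \<alpha> = ennreal (exp (\<integral>x. ln (infdist x \<alpha>) \<partial>\<nu>))"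
proof -
  let ?f = "\<lambda>x. ln (infdist x \<alpha>)"
  have int: "integrable \<nu> ?f" using assms by (rule integrable_ln_infdist)
  have "infdist x \<alpha> \<noteq> 0" if "x \<notin> \<alpha>" for x
    using that assms infdist_finite_attained[OF assms, of x] by (metis dist_eq_0_iff)
  then have AE: "AE x in \<nu>. log_dist \<alpha> x = ereal (?f x)"
    using AE_notin_finite[OF assms(1)] by (auto simp: log_dist_def elim!: eventually_mono)
  have pos: "(\<integral>\<^sup>+ x. e2ennreal (log_dist \<alpha> x) \<partial>\<nu>) = (\<integral>\<^sup>+ x. ennreal (?f x) \<partial>\<nu>)"
    by (rule nn_integral_cong_AE) (use AE in \<open>eventually_elim, simp\<close>)
  have neg: "(\<integral>\<^sup>+ x. e2ennreal (- log_dist \<alpha> x) \<partial>\<nu>) = (\<integral>\<^sup>+ x. ennreal (- ?f x) \<partial>\<nu>)"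
    by (rule nn_integral_cong_AE) (use AE in \<open>eventually_elim, simp\<close>)
  obtain p where p: "p \<ge> 0" "(\<integral>\<^sup>+ x. ennreal (?f x) \<partial>\<nu>) = ennreal p"
    using int by (metis real_integrable_def ennreal_cases infinity_ennreal_def)
  obtain n where n: "n \<ge> 0" "(\<integral>\<^sup>+ x. ennreal (- ?f x) \<partial>\<nu>) = ennreal n"
    using int by (metis real_integrable_def ennreal_cases infinity_ennreal_def)
  have "log_dist_integral \<nu> \<alpha> = ereal (integral\<^sup>L \<nu> ?f)"
    unfolding log_dist_integral_def pos neg real_lebesgue_integral_def[OF int] using p n by simp
  then show ?thesis by (simp add: geometric_error_def exp_ereal_def)
qed

text \<open>Monotonicity of \<open>exp\<close> reduces optimality to a comparison of real integrals,
  the form in which it is used below.\<close>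

lemma optimal_integral_le:
  assumes "\<alpha> \<in> optimal_sets k \<nu>" "\<beta> \<in> codebooks k"
  shows "(\<integral>x. ln (infdist x \<alpha>) \<partial>\<nu>) \<le> (\<integral>x. ln (infdist x \<beta>) \<partial>\<nu>)"
proof -
  have "geometric_error \<nu> \<alpha> \<le> geometric_error \<nu> \<beta>"
  proof -
    have "geometric_error \<nu> \<alpha> = (INF \<beta>\<in>codebooks k. geometric_error \<nu> \<beta>)"
      using assms(1) unfolding optimal_sets_def by blast
    then show ?thesis using INF_lower[OF assms(2)] by metis
  qed
  moreover have "\<alpha> \<in> codebooks k" using assms by (auto simp: optimal_sets_def)
  moreover have "finite \<gamma> \<and> \<gamma> \<noteq> {}" if "\<gamma> \<in> codebooks k" for \<gamma> :: "'a set"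
    using that by (auto simp: codebooks_def)
  ultimately show ?thesis using assms(2) by (simp add: geometric_error_eq)
qed

section \<open>The gain from adding a point\<close>

text \<open>The balls of radius \<open>r\<close> around \<beta> miss half of the mass. Among
  finitely many balls of radius \<open>r / 4\<close> covering \<open>K\<close>, one holds a fixed
  share of the missed part, and a new point at its center divides the distances there by at least
  4.\<close>

lemma adding_point_decreases_integral:
  obtains c where "c > 0"
    "\<And>\<beta>. finite \<beta> \<Longrightarrow> \<beta> \<noteq> {} \<Longrightarrow> card \<beta> \<le> k \<Longrightarrow>
      \<exists>b. (\<integral>x. ln (infdist x (insert b \<beta>)) \<partial>\<nu>) \<le> (\<integral>x. ln (infdist x \<beta>) \<partial>\<nu>) - c"
proof -
  \<comment> \<open>Chosen so that \<open>k\<close> balls of radius \<open>r\<close> have total mass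
    at most \<open>k / (2 * (k + 1))\<close>, hence at most 1/2; \<open>k + 1\<close> avoids
    division by zero.\<close>
  define r where "r = (1 / (2 * (real k + 1) * C)) powr (1 / t)"
  have r: "r > 0" unfolding r_def using C_pos by simp
  have "C * r powr t = 1 / (2 * (real k + 1))"
    unfolding r_def using C_pos t_pos by (simp add: powr_powr)
  then have kr: "real k * (C * r powr t) \<le> 1 / 2" by (simp only:) (simp add: field_simps)
  obtain X where X: "X \<subseteq> K" "finite X" "K \<subseteq> (\<Union>x\<in>X. ball x (r / 4))"
    using compactE_image[OF compact_K, of K "\<lambda>x. ball x (r / 4)"] r by force
  have "X \<noteq> {}" using X K_nonempty by auto
  then have card_X: "card X > 0" using X by (simp add: card_gt_0_iff)
  \<comment> \<open>A drop of \<open>ln 4\<close> on a set of mass at least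
    \<open>1 / (2 * card X)\<close>. The cover \<open>X\<close> is fixed before \<beta>, so
    \<open>c\<close> does not depend on \<beta>.\<close>
  define c where "c = ln 4 / (2 * real (card X))"
  have [measurable]: "cball x s \<in> sets \<nu>" for x s by (simp add: sets_eq)
  show thesis
  proof
    show "c > 0" using card_X by (simp add: c_def)
    fix \<beta> :: "'a set" assume \<beta>: "finite \<beta>" "\<beta> \<noteq> {}" "card \<beta> \<le> k"
    define A where "A = - (\<Union>b\<in>\<beta>. cball b r)"
    have S [measurable]: "(\<Union>b\<in>\<beta>. cball b r) \<in> sets \<nu>"
      using \<beta> by (intro sets.finite_UN) auto
    then have A [measurable]: "A \<in> sets \<nu>" unfolding A_def by (metis sets_eq borel_comp)
    have "prob (\<Union>b\<in>\<beta>. cball b r) \<le> (\<Sum>b\<in>\<beta>. prob (cball b r))"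
      using \<beta> by (intro finite_measure_subadditive_finite) auto
    also have "\<dots> \<le> (\<Sum>b\<in>\<beta>. C * r powr t)"
      using r by (intro sum_mono measure_cball_le)
    also have "\<dots> \<le> real k * (C * r powr t)"
      using \<beta> C_pos by (auto intro!: mult_right_mono)
    finally have "prob A \<ge> 1 / 2"
      using kr prob_compl[OF S] sets_eq_imp_space_eq[OF sets_eq] by (simp add: A_def Compl_eq_Diff_UNIV)
    also have "prob A \<le> prob (\<Union>x\<in>X. A \<inter> cball x (r / 4))"
    proof (rule finite_measure_mono_AE)
      show "AE x in \<nu>. x \<in> A \<longrightarrow> x \<in> (\<Union>x\<in>X. A \<inter> cball x (r / 4))"
        using AE_in_K by eventually_elim (use X(3) in \<open>force simp: less_imp_le\<close>)
      show "(\<Union>x\<in>X. A \<inter> cball x (r / 4)) \<in> sets \<nu>"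
        using X by (intro sets.finite_UN) auto
    qed
    also have "\<dots> \<le> (\<Sum>x\<in>X. prob (A \<inter> cball x (r / 4)))"
      using X by (intro finite_measure_subadditive_finite) auto
    finally have sum: "1 / 2 \<le> (\<Sum>x\<in>X. prob (A \<inter> cball x (r / 4)))" .
    \<comment> \<open>Pigeonhole: otherwise the masses would sum to less than 1/2.\<close>
    have "\<exists>b\<in>X. 1 / (2 * real (card X)) \<le> prob (A \<inter> cball b (r / 4))"
    proof (rule ccontr)
      assume "\<not> ?thesis"
      then have "(\<Sum>x\<in>X. prob (A \<inter> cball x (r / 4))) < (\<Sum>x\<in>X. 1 / (2 * real (card X)))"
        using X \<open>X \<noteq> {}\<close> by (intro sum_strict_mono) auto
      also have "\<dots> = 1 / 2" using card_X by simp
      finally show False using sum by simp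
    qed
    then obtain b where b: "1 / (2 * real (card X)) \<le> prob (A \<inter> cball b (r / 4))" by blast
    define E where "E = A \<inter> cball b (r / 4)"
    have [measurable]: "E \<in> sets \<nu>" by (simp add: E_def)
    have int_E: "integrable \<nu> (\<lambda>x. ln 4 * indicator E x :: real)"
      by (intro integrable_mult_right integrable_real_indicator) (auto simp: emeasure_eq_measure)
    have int_\<beta>: "integrable \<nu> (\<lambda>x. ln (infdist x \<gamma>))" if "\<gamma> = \<beta> \<or> \<gamma> = insert b \<beta>" for \<gamma>
      using that \<beta> by (intro integrable_ln_infdist) auto
    \<comment> \<open>The finitely many centers are left out because \<open>ln\<close> is monotone
      only on positive distances; they form a null set.\<close>
    have pw: "ln (infdist x (insert b \<beta>)) \<le> ln (infdist x \<beta>) - ln 4 * indicator E x"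
      if x: "x \<notin> insert b \<beta>" for x
    proof -
      obtain a where a: "a \<in> insert b \<beta>" "infdist x (insert b \<beta>) = dist x a"
        using infdist_finite_attained[of "insert b \<beta>" x] \<beta> by auto
      then have pos: "infdist x (insert b \<beta>) > 0" using x by auto
      have le: "infdist x (insert b \<beta>) \<le> infdist x \<beta>" using \<beta> by (intro infdist_insert_le)
      show ?thesis
      proof (cases "x \<in> E")
        case True
        obtain b' where b': "b' \<in> \<beta>" "infdist x \<beta> = dist x b'"
          using infdist_finite_attained[of \<beta> x] \<beta> by auto
        have "infdist x \<beta> > r" using True b' by (auto simp: E_def A_def dist_commute)
        moreover have "infdist x (insert b \<beta>) \<le> dist x b" by (intro infdist_le) auto
        moreover have "dist x b \<le> r / 4" using True by (auto simp: E_def dist_commute)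
        ultimately have "infdist x (insert b \<beta>) \<le> infdist x \<beta> / 4" by simp
        then have "ln (infdist x (insert b \<beta>)) \<le> ln (infdist x \<beta> / 4)"
          using pos by (subst ln_le_cancel_iff) auto
        also have "\<dots> = ln (infdist x \<beta>) - ln 4"
          using pos le by (subst ln_div) auto
        finally show ?thesis using True by simp
      next
        case False
        then show ?thesis using pos le by simp
      qed
    qed
    have "(\<integral>x. ln (infdist x (insert b \<beta>)) \<partial>\<nu>) \<le> (\<integral>x. ln (infdist x \<beta>) - ln 4 * indicator E x \<partial>\<nu>)"
    proof (rule integral_mono_AE)
      show "AE x in \<nu>. ln (infdist x (insert b \<beta>)) \<le> ln (infdist x \<beta>) - ln 4 * indicator E x"
        using AE_notin_finite[OF finite.insertI[OF \<beta>(1), of b]] by eventually_elim (rule pw)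
    qed (intro int_\<beta> int_E Bochner_Integration.integrable_diff disjI1 disjI2 refl)+
    also have "\<dots> = (\<integral>x. ln (infdist x \<beta>) \<partial>\<nu>) - ln 4 * prob E"
      by (subst Bochner_Integration.integral_diff[OF int_\<beta> int_E]) auto
    also have "\<dots> \<le> (\<integral>x. ln (infdist x \<beta>) \<partial>\<nu>) - c"
      using mult_left_mono[OF b, of "ln 4"] by (simp add: c_def E_def)
    finally show "\<exists>b. (\<integral>x. ln (infdist x (insert b \<beta>)) \<partial>\<nu>) \<le> (\<integral>x. ln (infdist x \<beta>) \<partial>\<nu>) - c" by blast
  qed
qed

section \<open>Deleting a point with a small cell\<close>

lemma optimal_integral_nonpos:
  assumes "\<alpha> \<in> optimal_sets k \<nu>"
  shows "(\<integral>x. ln (infdist x \<alpha>) \<partial>\<nu>) \<le> 0"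
proof -
  obtain y where y: "y \<in> K" using K_nonempty by auto
  \<comment> \<open>Membership of \<alpha> itself in \<open>codebooks k\<close> forces
    \<open>k\<close> to be at least 1.\<close>
  have "{y} \<in> codebooks k"
    using assms by (auto simp: optimal_sets_def codebooks_def)
  then have "(\<integral>x. ln (infdist x \<alpha>) \<partial>\<nu>) \<le> (\<integral>x. ln (infdist x {y}) \<partial>\<nu>)"
    by (rule optimal_integral_le[OF assms])
  also have "\<dots> \<le> (\<integral>x. 0 \<partial>\<nu>)"
  proof (rule integral_mono_AE)
    show "AE x in \<nu>. ln (infdist x {y}) \<le> 0"
      using AE_in_K by eventually_elim (use ln_infdist_le[OF _ y, of _ "{y}" 0] in auto)
  qed (use integrable_ln_infdist[of "{y}"] in auto)
  finally show ?thesis by simp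
qed

lemma voronoi_cell_lower_bound:
  obtains d where "d > 0"
    "\<And>\<alpha> P a. \<alpha> \<in> optimal_sets k \<nu> \<Longrightarrow> voronoi_partition \<alpha> P \<Longrightarrow> a \<in> \<alpha> \<Longrightarrow> d \<le> prob (P a)"
proof -
  \<comment> \<open>The case \<open>N = 0\<close> of the integral bound: it controls the negative
    part around any point \<open>a\<close> over the whole space.\<close>
  define M where "M = C / (1 - exp (- t))"
  have M: "M > 0" using C_pos t_pos by (simp add: M_def)
  have int_M: "(\<integral>x. neg_ln_dist a x \<partial>\<nu>) \<le> M" for a
    using integral_neg_ln_dist_le[of UNIV a 0] by (simp add: M_def sets_eq)
  \<comment> \<open>Bounds \<open>ln (infdist x \<beta>)\<close> on \<open>K\<close> once some point
    of \<open>K\<close> is within \<open>exp (2 * M + 2)\<close> of the reduced set \<beta>.\<close>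
  define L where "L = ln (exp (2 * M + 2) + 1)"
  have L: "L > 0" by (simp add: L_def add_pos_pos)
  obtain c where c: "c > 0"
    "\<And>\<beta>. finite \<beta> \<Longrightarrow> \<beta> \<noteq> {} \<Longrightarrow> card \<beta> \<le> k \<Longrightarrow>
      \<exists>b. (\<integral>x. ln (infdist x (insert b \<beta>)) \<partial>\<nu>) \<le> (\<integral>x. ln (infdist x \<beta>) \<partial>\<nu>) - c"
    by (rule adding_point_decreases_integral[of k]) blast
  have "c / 4 > 0" using c by simp
  then obtain \<delta> where \<delta>: "\<delta> > 0"
    "\<And>a A. A \<in> sets \<nu> \<Longrightarrow> prob A \<le> \<delta> \<Longrightarrow> (\<integral>x. indicator A x * neg_ln_dist a x \<partial>\<nu>) \<le> c / 4"
    using uniformly_integrable_neg_ln_dist by blast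
  \<comment> \<open>The bound 1/2 keeps the reduced set nonempty and near the support; \<delta> and
    \<open>c / (4 * L)\<close> limit the two costs of the deletion to \<open>c / 4\<close>
    each.\<close>
  define d where "d = min (1 / 2) (min \<delta> (c / (4 * L)))"
  show thesis
  proof
    show "d > 0" using \<delta> c L by (simp add: d_def)
    fix \<alpha> P a assume opt: "\<alpha> \<in> optimal_sets k \<nu>" and P: "voronoi_partition \<alpha> P" and a: "a \<in> \<alpha>"
    have fin: "finite \<alpha>" and card: "card \<alpha> \<le> k"
      using opt by (auto simp: optimal_sets_def codebooks_def)
    show "d \<le> prob (P a)"
    proof (rule ccontr)
      assume "\<not> d \<le> prob (P a)"
      then have small: "prob (P a) < d" by simp
      define \<beta> where "\<beta> = \<alpha> - {a}"
      have Pa [measurable]: "P a \<in> sets \<nu>" using P a by (auto simp: voronoi_partition_def sets_eq)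
      have int_ind: "integrable \<nu> (indicator (P a) :: 'a \<Rightarrow> real)"
        by (intro integrable_real_indicator) (auto simp: emeasure_eq_measure)
      have "\<beta> \<noteq> {}"
      proof
        assume "\<beta> = {}"
        then have "\<alpha> = {a}" using a by (auto simp: \<beta>_def)
        then have "P a = space \<nu>"
          using P sets_eq_imp_space_eq[OF sets_eq] by (auto simp: voronoi_partition_def)
        then show False using small prob_space by (auto simp: d_def)
      qed
      have fin_\<beta>: "finite \<beta>" and card_\<beta>: "card \<beta> < card \<alpha>"
        using fin a by (simp_all only: \<beta>_def finite_Diff card_Diff1_less)
      have \<alpha>_in: "infdist x \<alpha> = dist x a" if "x \<in> P a" for x
        using that P a by (auto simp: voronoi_partition_def voronoi_region_def)
      have \<alpha>_out: "infdist x \<alpha> = infdist x \<beta>" if "x \<notin> P a" for x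
        unfolding \<beta>_def using P a that by (rule infdist_eq_infdist_Diff_if_notin_cell)
      have int_\<alpha>: "integrable \<nu> (\<lambda>x. ln (infdist x \<alpha>))"
        using fin a by (intro integrable_ln_infdist) auto
      have int_\<beta>: "integrable \<nu> (\<lambda>x. ln (infdist x \<beta>))"
        using fin_\<beta> \<open>\<beta> \<noteq> {}\<close> by (intro integrable_ln_infdist) auto

      \<comment> \<open>If \<beta> were far from all of \<open>K\<close>, the mass outside the cell,
        more than 1/2, would contribute at least \<open>M + 1\<close>, while the negative part
        around \<open>a\<close> takes away at most \<open>M\<close>. The integral would be positive,
        against optimality.\<close>
      have "\<exists>y\<in>K. infdist y \<beta> \<le> exp (2 * M + 2)"
      proof (rule ccontr)
        assume "\<not> ?thesis"
        then have far: "exp (2 * M + 2) < infdist y \<beta>" if "y \<in> K" for y using that by auto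
        have pw: "(2 * M + 2) * (1 - indicator (P a) x) - neg_ln_dist a x \<le> ln (infdist x \<alpha>)"
          if "x \<in> K" for x
        proof (cases "x \<in> P a")
          case True
          then show ?thesis by (simp add: \<alpha>_in neg_ln_dist_def)
        next
          case False
          have "2 * M + 2 \<le> ln (infdist x \<beta>)"
            using far[OF that] by (subst ln_ge_iff) (auto intro: less_trans[OF exp_gt_zero])
          then show ?thesis using False neg_ln_dist_nonneg[of a x] by (simp add: \<alpha>_out)
        qed
        have "(2 * M + 2) * (1 - prob (P a)) - (\<integral>x. neg_ln_dist a x \<partial>\<nu>)
            = (\<integral>x. (2 * M + 2) * (1 - indicator (P a) x) - neg_ln_dist a x \<partial>\<nu>)"
        proof -
          have "integrable \<nu> (\<lambda>x. (2 * M + 2) * (1 - indicator (P a) x))"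
            by (intro integrable_mult_right Bochner_Integration.integrable_diff integrable_const int_ind)
          moreover have "(\<integral>x. 1 - indicator (P a) x \<partial>\<nu>) = 1 - prob (P a)"
            using prob_space by (subst Bochner_Integration.integral_diff) (auto intro: int_ind)
          ultimately show ?thesis
            by (subst Bochner_Integration.integral_diff) (auto intro: integrable_neg_ln_dist)
        qed
        also have "\<dots> \<le> (\<integral>x. ln (infdist x \<alpha>) \<partial>\<nu>)"
        proof (rule integral_mono_AE)
          show "AE x in \<nu>. (2 * M + 2) * (1 - indicator (P a) x) - neg_ln_dist a x \<le> ln (infdist x \<alpha>)"
            using AE_in_K by eventually_elim (rule pw)
        qed (intro int_\<alpha> Bochner_Integration.integrable_diff integrable_neg_ln_dist
                integrable_mult_right integrable_const int_ind)+
        also have "\<dots> \<le> 0" using opt by (rule optimal_integral_nonpos)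
        finally have "(2 * M + 2) * (1 - prob (P a)) \<le> M" using int_M[of a] by simp
        moreover have "(2 * M + 2) * (1 / 2) \<le> (2 * M + 2) * (1 - prob (P a))"
          using small M by (intro mult_left_mono) (auto simp: d_def)
        ultimately show False by simp
      qed
      then obtain y where y: "y \<in> K" "infdist y \<beta> \<le> exp (2 * M + 2)" by blast
      \<comment> \<open>On the cell, \<open>ln (dist x a)\<close> plus its negative part is
        nonnegative, so \<open>L\<close> alone bounds the left side; off the cell nothing
        changes.\<close>
      have pw: "ln (infdist x \<beta>) \<le> ln (infdist x \<alpha>) + (L * indicator (P a) x + indicator (P a) x * neg_ln_dist a x)"
        if "x \<in> K" for x
      proof (cases "x \<in> P a")
        case True
        have "ln (infdist x \<beta>) \<le> L" unfolding L_def using that y by (intro ln_infdist_le) auto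
        then show ?thesis using True by (simp add: \<alpha>_in neg_ln_dist_def)
      next
        case False
        then show ?thesis by (simp add: \<alpha>_out)
      qed
      have "(\<integral>x. ln (infdist x \<beta>) \<partial>\<nu>) \<le>
          (\<integral>x. ln (infdist x \<alpha>) + (L * indicator (P a) x + indicator (P a) x * neg_ln_dist a x) \<partial>\<nu>)"
      proof (rule integral_mono_AE)
        show "AE x in \<nu>. ln (infdist x \<beta>) \<le>
            ln (infdist x \<alpha>) + (L * indicator (P a) x + indicator (P a) x * neg_ln_dist a x)"
          using AE_in_K by eventually_elim (rule pw)
      qed (intro int_\<alpha> int_\<beta> Bochner_Integration.integrable_add integrable_mult_right int_ind
              integrable_indicator_neg_ln_dist Pa)+
      also have "\<dots> = (\<integral>x. ln (infdist x \<alpha>) \<partial>\<nu>) +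
          (L * prob (P a) + (\<integral>x. indicator (P a) x * neg_ln_dist a x \<partial>\<nu>))"
        using int_ind by (simp add: int_\<alpha> integrable_indicator_neg_ln_dist)
      also have "(\<integral>x. indicator (P a) x * neg_ln_dist a x \<partial>\<nu>) \<le> c / 4"
        using small by (intro \<delta>) (auto simp: d_def)
      also have "L * prob (P a) \<le> L * (c / (4 * L))"
        using small L by (intro mult_left_mono) (auto simp: d_def)
      also have "\<dots> = c / 4" using L by simp
      finally have 1: "(\<integral>x. ln (infdist x \<beta>) \<partial>\<nu>) \<le> (\<integral>x. ln (infdist x \<alpha>) \<partial>\<nu>) + c / 2" by simp
      obtain b where b: "(\<integral>x. ln (infdist x (insert b \<beta>)) \<partial>\<nu>) \<le> (\<integral>x. ln (infdist x \<beta>) \<partial>\<nu>) - c"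
        using c(2)[OF fin_\<beta> \<open>\<beta> \<noteq> {}\<close>] card card_\<beta> by auto
      \<comment> \<open>\<beta> has one point fewer than \<alpha>, so there is room for
        \<open>b\<close>. The exchange costs at most \<open>c / 2\<close> and gains at least
        \<open>c\<close>, so it beats the optimal set.\<close>
      have "insert b \<beta> \<in> codebooks k"
        using fin_\<beta> card card_\<beta>
        by (auto simp: codebooks_def card_insert_if Suc_le_eq card_gt_0_iff)
      then have "(\<integral>x. ln (infdist x \<alpha>) \<partial>\<nu>) \<le> (\<integral>x. ln (infdist x (insert b \<beta>)) \<partial>\<nu>)"
        by (rule optimal_integral_le[OF opt])
      then show False using 1 b c(1) by simp
    qed
  qed
qed

end

section \<open>Specialization to the support in Euclidean space\<close>

theorem lemma3p2:
  fixes \<nu> :: "(real ^ 'q) measure" and C t :: real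
  assumes "C > 0" and "t > 0"
    and "prob_space \<nu>" and "sets \<nu> = sets borel"
    and "compact (measure_support \<nu>)"
    and "diameter (measure_support \<nu>) \<le> 1"
    and "\<And>\<epsilon>::real. \<epsilon> > 0 \<Longrightarrow> (SUP x. measure \<nu> (cball x \<epsilon>)) \<le> C * \<epsilon> powr t"
  shows "\<forall>k\<ge>2. \<exists>d::real. d > 0 \<and>
           (\<forall>\<alpha> \<in> optimal_sets k \<nu>. \<forall>P. voronoi_partition \<alpha> P \<longrightarrow>
              Min ((\<lambda>a. measure \<nu> (P a)) ` \<alpha>) \<ge> d)"
proof (intro allI impI)
  interpret prob_space \<nu> by (rule assms(3))
  have regular: "upper_regular_measure \<nu> (measure_support \<nu>) C t"
  proof (intro upper_regular_measure.intro upper_regular_measure_axioms.intro)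
    show "AE x in \<nu>. x \<in> measure_support \<nu>"
    proof (rule AE_I)
      show "- measure_support \<nu> \<in> sets \<nu>"
        unfolding assms(4) using assms(5) by (intro borel_comp borel_closed compact_imp_closed)
      show "emeasure \<nu> (- measure_support \<nu>) = 0"
        using assms(4) by (rule emeasure_compl_measure_support)
    qed auto
    show "dist x y \<le> 1" if "x \<in> measure_support \<nu>" "y \<in> measure_support \<nu>" for x y
      using diameter_bounded_bound[OF compact_imp_bounded[OF assms(5)] that] assms(6) by simp
    show "prob (cball x \<epsilon>) \<le> C * \<epsilon> powr t" if "\<epsilon> > 0" for x \<epsilon>
    proof -
      \<comment> \<open>The real supremum bounds each value because probabilities are bounded above
        by 1.\<close>
      have "prob (cball x \<epsilon>) \<le> (SUP x. prob (cball x \<epsilon>))"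
        by (intro cSUP_upper bdd_aboveI[where M = 1]) auto
      then show ?thesis using assms(7)[OF that] by simp
    qed
  qed (fact assms)+
  fix k :: nat
  obtain d where d: "d > 0"
    "\<And>\<alpha> P a. \<alpha> \<in> optimal_sets k \<nu> \<Longrightarrow> voronoi_partition \<alpha> P \<Longrightarrow> a \<in> \<alpha> \<Longrightarrow> d \<le> prob (P a)"
    by (rule upper_regular_measure.voronoi_cell_lower_bound[OF regular, of k]) blast
  have "d \<le> Min ((\<lambda>a. prob (P a)) ` \<alpha>)"
    if "\<alpha> \<in> optimal_sets k \<nu>" "voronoi_partition \<alpha> P" for \<alpha> P
  proof -
    \<comment> \<open>\<open>Min\<close> is meaningful only on finite nonempty sets, which
      membership in \<open>codebooks k\<close> ensures.\<close>
    have "finite \<alpha>" "\<alpha> \<noteq> {}" using that(1) by (auto simp: optimal_sets_def codebooks_def)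
    then show ?thesis using d(2)[OF that] by (subst Min_ge_iff) auto
  qed
  then show "\<exists>d>0. \<forall>\<alpha>\<in>optimal_sets k \<nu>. \<forall>P. voronoi_partition \<alpha> P \<longrightarrow> d \<le> Min ((\<lambda>a. prob (P a)) ` \<alpha>)"
    using d(1) by blast
qed

end
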